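(* Let $k\ge 3$ be an integer, and let $G$ be a finite graph such that every edge of $G$ is contained in a cycle of length at most $k$. Let $A$ and $B$ be abelian groups of cardinality at least $k+1$. Then the diameter of $\mathcal{F}(G,A\times B)$ is at most $4|E(G)|$; in particular $\mathcal{F}(G,A\times B)$ is connected.
   Context: Graphs may have multiple edges but no loops. For a fixed orientation of $G$ and an abelian group $\Gamma$, a $\Gamma$-flow is a map $f:E(G)\to\Gamma$ such that at each vertex the sum of values on outgoing arcs equals the sum on incoming arcs; it is nowhere-zero if no edge receives $0_\Gamma$. A cycle is a connected 2-regular subgraph. $\mathcal{F}(G,\Gamma)$ is the graph whose vertices are the nowhere-zero $\Gamma$-flows of $G$, two flows $f,g$ adjacent iff $\{e:(f-g)(e)\ne0\}$ is the edge set of a cycle. The empty graph is considered connected (with diameter $0$). *)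

theory Defs
  imports
    "Graph_Theory.Graph_Theory"
    "HOL-Library.FuncSet"
    "HOL-Library.Product_Plus"
    "HOL-Library.Extended_Nat"
begin

text \<open>
  A multigraph together with a fixed orientation is a digraph whose arcs are the oriented edges;
  parallel and antiparallel arcs both stand for parallel edges. Notions that do not depend on the
  orientation (cycles, connectedness) are taken in the underlying undirected multigraph.
\<close>

text \<open>Flows live on the arcs only, hence the extensionality condition.\<close>

definition is_flow :: "('v, 'e) pre_digraph \<Rightarrow> ('e \<Rightarrow> 'c::ab_group_add) \<Rightarrow> bool" where
  "is_flow G f \<longleftrightarrow> f \<in> extensional (arcs G) \<and>
     (\<forall>v\<in>verts G. (\<Sum>e\<in>out_arcs G v. f e) = (\<Sum>e\<in>in_arcs G v. f e))"

definition nowhere_zero_flow :: "('v, 'e) pre_digraph \<Rightarrow> ('e \<Rightarrow> 'c::ab_group_add) \<Rightarrow> bool" where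
  "nowhere_zero_flow G f \<longleftrightarrow> is_flow G f \<and> (\<forall>e\<in>arcs G. f e \<noteq> 0)"

text \<open>
  A connected 2-regular subgraph of the underlying undirected multigraph. The undirected degree of a
  vertex in a loopless graph is the sum of its in- and out-degree, and \<^const>\<open>Digraph_Component.connected\<close>
  ignores orientations and requires a nonempty vertex set. Two parallel edges form a cycle of length 2.
\<close>

definition cycle_subgraph :: "('v, 'e) pre_digraph \<Rightarrow> ('v, 'e) pre_digraph \<Rightarrow> bool" where
  "cycle_subgraph C G \<longleftrightarrow> subgraph C G \<and> Digraph_Component.connected C \<and>
     (\<forall>v\<in>verts C. in_degree C v + out_degree C v = 2)"

text \<open>
  Simple undirected graphs are represented by symmetric digraphs whose arcs are pairs of vertices.
\<close>

definition flow_graph :: "('v, 'e) pre_digraph \<Rightarrow> 'c::ab_group_add itself \<Rightarrow>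
    ('e \<Rightarrow> 'c, ('e \<Rightarrow> 'c) \<times> ('e \<Rightarrow> 'c)) pre_digraph" where
  "flow_graph G _ = \<lparr>
     verts = {f. nowhere_zero_flow G f},
     arcs = {(f, g). nowhere_zero_flow G f \<and> nowhere_zero_flow G g \<and>
               (\<exists>C. cycle_subgraph C G \<and> {e \<in> arcs G. f e - g e \<noteq> 0} = arcs C)},
     tail = fst,
     head = snd\<rparr>"

lemma wf_digraph_flow_graph: "wf_digraph (flow_graph G T)"
  by unfold_locales (auto simp: flow_graph_def)

lemma symmetric_flow_graph:
  fixes G :: "('v, 'e) pre_digraph" and T :: "'c::ab_group_add itself"
  shows "symmetric (flow_graph G T)"
proof -
  have "{e \<in> arcs G. g e \<noteq> f e} = {e \<in> arcs G. f e \<noteq> g e}" for f g :: "'e \<Rightarrow> 'c"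
    by auto
  then show ?thesis
    by (simp add: symmetric_def arcs_ends_def arc_to_ends_def flow_graph_def sym_def image_iff) metis
qed

text \<open>
  In \<^typ>\<open>enat\<close> the infimum of the empty set is \<open>\<infinity>\<close> and the supremum of the empty set is \<open>0\<close>: vertices in
  different components have distance \<open>\<infinity>\<close>, and the empty graph has diameter \<open>0\<close>.
\<close>

definition graph_distance :: "('v, 'e) pre_digraph \<Rightarrow> 'v \<Rightarrow> 'v \<Rightarrow> enat" where
  "graph_distance H u v = (INF p\<in>{p. pre_digraph.awalk H u p v}. enat (length p))"

definition graph_diameter :: "('v, 'e) pre_digraph \<Rightarrow> enat" where
  "graph_diameter H = (SUP (u, v)\<in>verts H \<times> verts H. graph_distance H u v)"

lemma graph_diameter_empty: "verts H = {} \<Longrightarrow> graph_diameter H = 0"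
  by (simp add: graph_diameter_def bot_enat_def)

definition connected_or_empty :: "('v, 'e) pre_digraph \<Rightarrow> bool" where
  "connected_or_empty H \<longleftrightarrow> verts H = {} \<or> Digraph_Component.connected H"

end

theory Submission
  imports Defs
begin

text \<open>
  If \<open>f\<close> vanishes in the first coordinate at \<open>e\<close>, choose a cycle of length at most \<open>k\<close> through \<open>e\<close>.
  At most \<open>k\<close> values \<open>a \<in> A\<close> are forbidden if adding \<open>\<plusminus>a\<close> along the cycle is to make the first coordinate
  nonzero on the whole cycle, so some \<open>a\<close> works. Hence \<open>|E|\<close> steps turn \<open>f\<close> into a flow \<open>f\<^sub>1\<close> with
  nowhere-zero first coordinate, and likewise \<open>g\<close> into \<open>g\<^sub>1\<close> with nowhere-zero second coordinate.
  Every flow is a sum of at most \<open>|E|\<close> flows \<open>\<plusminus>a\<close> on cycles. Applied to the difference of the second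
  coordinates this leads from \<open>f\<^sub>1\<close> to \<open>(fst f\<^sub>1, snd g\<^sub>1)\<close>, applied to the difference of the first ones it
  leads on to \<open>g\<^sub>1\<close>, and nothing can become zero as the other coordinate is nowhere zero throughout.

  A graph with at least as many edges as vertices carries a nonzero real flow. This yields both the
  signs \<open>\<plusminus>\<close> along a given cycle and the existence of cycles.
\<close>

section \<open>Real flows\<close>

text \<open>Gaussian elimination, by induction on the set of equations: a trivial equation is
  dropped, any other is used to eliminate one unknown \<open>e0\<close>.\<close>

lemma underdetermined_system_nontrivial_solution:
  fixes M :: "'i \<Rightarrow> 'j \<Rightarrow> 'f::field"
  assumes "finite V" "finite E" "card V < card E"
  shows "\<exists>x. (\<exists>e\<in>E. x e \<noteq> 0) \<and> (\<forall>v\<in>V. (\<Sum>e\<in>E. M v e * x e) = 0)"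
  using assms
proof (induction V arbitrary: E M rule: finite_induct)
  case empty
  then have "E \<noteq> {}" by auto
  then show ?case by (intro exI[of _ "\<lambda>_. 1"]) auto
next
  case (insert v V)
  show ?case
  proof (cases "\<forall>e\<in>E. M v e = 0")
    case True
    have "card V < card E" using insert by simp
    then obtain x where "\<exists>e\<in>E. x e \<noteq> 0" "\<forall>u\<in>V. (\<Sum>e\<in>E. M u e * x e) = 0"
      using insert.IH[OF insert.prems(1)] by blast
    moreover have "(\<Sum>e\<in>E. M v e * x e) = 0" using True by simp
    ultimately show ?thesis by blast
  next
    case False
    then obtain e0 where e0: "e0 \<in> E" "M v e0 \<noteq> 0" by blast
    have fin: "finite (E - {e0})" "card V < card (E - {e0})"
      using insert e0 by (auto simp: card_Diff_singleton)
    obtain x where x: "\<exists>e\<in>E - {e0}. x e \<noteq> 0"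
      "\<forall>u\<in>V. (\<Sum>e\<in>E - {e0}. (M u e - M u e0 * M v e / M v e0) * x e) = 0"
      using insert.IH[OF fin, of "\<lambda>u e. M u e - M u e0 * M v e / M v e0"] by blast
    \<comment> \<open>The value at \<open>e0\<close> is the one that equation \<open>v\<close>
      forces; in every other equation it turns the reduced coefficients back into those of
      \<open>M\<close>.\<close>
    define y where "y = x(e0 := - (\<Sum>e\<in>E - {e0}. M v e * x e) / M v e0)"
    have split: "(\<Sum>e\<in>E. M u e * y e) = M u e0 * y e0 + (\<Sum>e\<in>E - {e0}. M u e * x e)" for u
      by (subst sum.remove[OF insert.prems(1) e0(1)]) (auto simp: y_def intro!: sum.cong)
    have "(\<Sum>e\<in>E. M u e * y e) = 0" if "u \<in> V" for u
    proof -
      have "0 = (\<Sum>e\<in>E - {e0}. M u e * x e - (M u e0 / M v e0) * (M v e * x e))"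
        using x(2) that by (simp add: algebra_simps)
      also have "\<dots> = (\<Sum>e\<in>E - {e0}. M u e * x e) - (M u e0 / M v e0) * (\<Sum>e\<in>E - {e0}. M v e * x e)"
        by (simp add: sum_subtractf sum_distrib_left)
      also have "\<dots> = (\<Sum>e\<in>E. M u e * y e)"
        unfolding split by (simp add: y_def)
      finally show ?thesis by simp
    qed
    moreover have "(\<Sum>e\<in>E. M v e * y e) = 0"
      unfolding split using e0 by (simp add: y_def)
    moreover have "\<exists>e\<in>E. y e \<noteq> 0" using x(1) by (auto simp: y_def)
    ultimately show ?thesis by blast
  qed
qed

text \<open>A single sum over an arbitrary arc set, so that conservation can be stated for cycles
  and supports without forming subgraphs, and additivity in \<open>f\<close> is immediate.\<close>

definition net_outflow :: "('v, 'e) pre_digraph \<Rightarrow> 'e set \<Rightarrow> ('e \<Rightarrow> 'c::ab_group_add) \<Rightarrow> 'v \<Rightarrow> 'c" where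
  "net_outflow G S f v = (\<Sum>e\<in>S. (if tail G e = v then f e else 0) - (if head G e = v then f e else 0))"

definition incident_arcs :: "('v, 'e) pre_digraph \<Rightarrow> 'e set \<Rightarrow> 'v \<Rightarrow> 'e set" where
  "incident_arcs G S v = {e \<in> S. tail G e = v \<or> head G e = v}"

lemma net_outflow_incident_arcs:
  assumes "finite S"
  shows "net_outflow G S f v = net_outflow G (incident_arcs G S v) f v"
  unfolding net_outflow_def incident_arcs_def
  by (intro sum.mono_neutral_right) (use assms in auto)

lemma net_outflow_cong:
  "(\<And>e. e \<in> S \<Longrightarrow> f e = g e) \<Longrightarrow> net_outflow G S f v = net_outflow G S g v"
  unfolding net_outflow_def by (auto intro!: sum.cong)

lemma net_outflow_add:
  "net_outflow G S (\<lambda>e. f e + g e) v = net_outflow G S f v + net_outflow G S g v"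
  unfolding net_outflow_def by (auto simp: sum.distrib[symmetric] intro!: sum.cong)

lemma net_outflow_additive:
  assumes "additive p"
  shows "net_outflow G S (\<lambda>e. p (f e)) v = p (net_outflow G S f v)"
  unfolding net_outflow_def additive.sum[OF assms] additive.diff[OF assms]
  by (auto simp: additive.zero[OF assms] intro!: sum.cong)

lemma net_outflow_diff:
  "net_outflow G S (\<lambda>e. f e - g e) v = net_outflow G S f v - net_outflow G S g v"
  using net_outflow_add[of G S "\<lambda>e. f e - g e" g v] by simp

lemma net_outflow_support:
  assumes "finite S"
  shows "net_outflow G S f v = net_outflow G {e \<in> S. f e \<noteq> 0} f v"
  unfolding net_outflow_def
  by (intro sum.mono_neutral_right) (use assms in auto)

text \<open>The net outflows of all vertices add up to 0, so conservation at one vertex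
  \<open>w\<close> follows from the rest. This leaves \<open>card W - 1\<close> equations, fewer
  than the \<open>card S\<close> unknowns.\<close>

lemma exists_nonzero_real_flow:
  fixes G :: "('v, 'e) pre_digraph"
  assumes "finite S" "finite W" "W \<noteq> {}" "card W \<le> card S"
    and ends: "\<And>e. e \<in> S \<Longrightarrow> tail G e \<in> W \<and> head G e \<in> W"
  shows "\<exists>x :: 'e \<Rightarrow> real. (\<exists>e\<in>S. x e \<noteq> 0) \<and> (\<forall>v. net_outflow G S x v = 0)"
proof -
  obtain w where w: "w \<in> W" using assms(3) by blast
  let ?M = "\<lambda>v e. (if tail G e = v then 1 else 0) - (if head G e = v then 1 else 0) :: real"
  have "card (W - {w}) < card S"
    using w assms by (metis card_Diff1_less less_le_trans)
  then obtain x where x: "\<exists>e\<in>S. x e \<noteq> 0" "\<forall>v\<in>W - {w}. (\<Sum>e\<in>S. ?M v e * x e) = 0"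
    using underdetermined_system_nontrivial_solution[of "W - {w}" S ?M] assms by blast
  have M: "(\<Sum>e\<in>S. ?M v e * x e) = net_outflow G S x v" for v
    unfolding net_outflow_def by (intro sum.cong) auto
  \<comment> \<open>Summed over vertices first, each arc contributes \<open>x e\<close> at its tail
    and \<open>- x e\<close> at its head, and both ends lie in \<open>W\<close>.\<close>
  have "(\<Sum>v\<in>W. net_outflow G S x v) = 0"
    unfolding net_outflow_def
    by (subst sum.swap) (use ends assms(2) in \<open>auto simp: sum_subtractf intro!: sum.neutral\<close>)
  moreover have "(\<Sum>v\<in>W - {w}. net_outflow G S x v) = 0"
    using x(2) M by (auto intro!: sum.neutral)
  ultimately have "net_outflow G S x w = 0"
    by (simp add: sum.remove[OF assms(2) w])
  moreover have "net_outflow G S x v = 0" if "v \<notin> W" for v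
    unfolding net_outflow_def using that ends by (auto intro!: sum.neutral)
  ultimately show ?thesis using x M by (metis Diff_iff singletonD)
qed

section \<open>Cycles\<close>

lemma connected_closed_set:
  assumes "Digraph_Component.connected C" "u \<in> verts C" "u \<in> R"
    and "\<And>e. e \<in> arcs C \<Longrightarrow> tail C e \<in> R \<longleftrightarrow> head C e \<in> R"
  shows "verts C \<subseteq> R"
proof
  fix v assume "v \<in> verts C"
  then have "u \<rightarrow>\<^sup>*\<^bsub>mk_symmetric C\<^esub> v"
    using assms(1,2) unfolding Digraph_Component.connected_def strongly_connected_def by simp
  then have "(u, v) \<in> (parcs (mk_symmetric C))\<^sup>*"
    using reachable_rtranclI by fastforce
  then show "v \<in> R"
    by (induction rule: rtrancl_induct) (use assms(3,4) in \<open>auto simp: parcs_mk_symmetric\<close>)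
qed

text \<open>The set of vertices reachable from \<open>u\<close> in the symmetric closure is itself
  closed under arcs, so the criterion applies to it.\<close>

lemma connectedI_closed_sets:
  assumes "wf_digraph C" "verts C \<noteq> {}"
    and closed: "\<And>u R. u \<in> verts C \<Longrightarrow> u \<in> R \<Longrightarrow>
      (\<And>e. e \<in> arcs C \<Longrightarrow> tail C e \<in> R \<longleftrightarrow> head C e \<in> R) \<Longrightarrow> verts C \<subseteq> R"
  shows "Digraph_Component.connected C"
proof -
  interpret S: pair_wf_digraph "mk_symmetric C"
    using assms(1) by (rule wf_digraph.wellformed_mk_symmetric)
  have "u \<rightarrow>\<^sup>*\<^bsub>mk_symmetric C\<^esub> v" if "u \<in> verts C" "v \<in> verts C" for u v
  proof -
    have "verts C \<subseteq> {v. (u, v) \<in> (parcs (mk_symmetric C))\<^sup>*}"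
      using that(1)
      by (rule closed) (auto simp: parcs_mk_symmetric intro: rtrancl_into_rtrancl)
    then have "(u, v) \<in> (arcs_ends (with_proj (mk_symmetric C)))\<^sup>*"
      using that by auto
    then show ?thesis
      using that by (subst S.reachable_conv) auto
  qed
  then show ?thesis
    using assms(2) unfolding Digraph_Component.connected_def strongly_connected_def by simp
qed

section \<open>Degrees and cycles in finite loopless multigraphs\<close>

locale fin_loopfree_digraph = fin_digraph G + loopfree_digraph G for G :: "('v, 'e) pre_digraph"
begin

lemma card_incident_arcs:
  assumes "subgraph C G"
  shows "card (incident_arcs G (arcs C) v) = in_degree C v + out_degree C v"
proof -
  have C: "tail C = tail G" "head C = head G" "arcs C \<subseteq> arcs G"
    using assms by (auto simp: subgraph_def compatible_def)
  have fin: "finite (arcs C)" using C(3) finite_arcs by (rule finite_subset)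
  have "incident_arcs G (arcs C) v = in_arcs C v \<union> out_arcs C v"
    using C by (auto simp: incident_arcs_def in_arcs_def out_arcs_def)
  moreover have "in_arcs C v \<inter> out_arcs C v = {}"
    using C no_loops by (auto simp: in_arcs_def out_arcs_def)
  ultimately show ?thesis
    using fin by (simp add: in_degree_def out_degree_def card_Un_disjoint in_arcs_def out_arcs_def)
qed

text \<open>Double counting of incidences: without loops every arc has exactly two ends, both in
  \<open>W\<close>.\<close>

lemma handshake:
  assumes "S \<subseteq> arcs G" "finite W" "\<And>e. e \<in> S \<Longrightarrow> tail G e \<in> W \<and> head G e \<in> W"
  shows "(\<Sum>v\<in>W. card (incident_arcs G S v)) = 2 * card S"
proof -
  have fin: "finite S" using assms(1) finite_arcs by (rule finite_subset)
  have "(\<Sum>v\<in>W. card (incident_arcs G S v)) = (\<Sum>v\<in>W. \<Sum>e\<in>S. if tail G e = v \<or> head G e = v then 1 else 0)"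
    using fin by (intro sum.cong) (auto simp: incident_arcs_def sum.If_cases Int_def)
  also have "\<dots> = (\<Sum>e\<in>S. card {v\<in>W. tail G e = v \<or> head G e = v})"
    using assms(2) by (subst sum.swap) (auto simp: sum.If_cases Int_def)
  also have "\<dots> = (\<Sum>e\<in>S. 2)"
  proof (intro sum.cong refl)
    fix e assume e: "e \<in> S"
    then have "{v\<in>W. tail G e = v \<or> head G e = v} = {tail G e, head G e}"
      using assms(3) by auto
    then show "card {v\<in>W. tail G e = v \<or> head G e = v} = 2"
      using e assms(1) no_loops by (auto simp: card_insert_if)
  qed
  finally show ?thesis by simp
qed

text \<open>A single nonzero value at \<open>v\<close> has nothing to balance it. Hence supports of
  flows qualify for the extraction of cycles.\<close>

lemma support_no_leaf:
  assumes "S \<subseteq> arcs G" "net_outflow G S f v = 0"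
  shows "card (incident_arcs G {e \<in> S. f e \<noteq> 0} v) \<noteq> 1"
proof
  have fin: "finite S" using assms(1) finite_arcs by (rule finite_subset)
  assume "card (incident_arcs G {e \<in> S. f e \<noteq> 0} v) = 1"
  then obtain e where e: "incident_arcs G {e \<in> S. f e \<noteq> 0} v = {e}"
    by (auto simp: card_1_singleton_iff)
  then have "e \<in> S" "f e \<noteq> 0" "tail G e = v \<or> head G e = v"
    by (auto simp: incident_arcs_def)
  moreover have "net_outflow G {e} f v = 0"
    using fin assms(2) e net_outflow_support[of S G f v]
      net_outflow_incident_arcs[of "{e \<in> S. f e \<noteq> 0}" G f v] by simp
  ultimately show False
    using assms(1) no_loops[of e] by (auto simp: net_outflow_def split: if_splits)
qed

text \<open>
  An inclusion-minimal nonempty arc set without vertices of degree 1 is a cycle: with more arcs than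
  vertices, the support of a real flow avoiding some arc would be smaller.
\<close>

lemma exists_cycle_no_leaf:
  assumes "A \<subseteq> arcs G" "A \<noteq> {}" "\<And>v. card (incident_arcs G A v) \<noteq> 1"
  shows "\<exists>C. cycle_subgraph C G \<and> arcs C \<subseteq> A"
proof -
  define P where "P S \<longleftrightarrow> S \<subseteq> A \<and> S \<noteq> {} \<and> (\<forall>v. card (incident_arcs G S v) \<noteq> 1)" for S
  have "P A" using assms by (simp add: P_def)
  then obtain S where S: "P S" and min: "\<And>T. P T \<Longrightarrow> card S \<le> card T"
    using ex_has_least_nat[of P A card] by blast
  have SG: "S \<subseteq> arcs G" and SA: "S \<subseteq> A" and S0: "S \<noteq> {}" using S assms(1) by (auto simp: P_def)
  have fin: "finite S" using SG finite_arcs by (rule finite_subset)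
  have min': "T = S" if "P T" "T \<subseteq> S" for T
    using min[OF that(1)] that(2) fin by (metis card_seteq)
  define W where "W = tail G ` S \<union> head G ` S"
  define C where "C = \<lparr>verts = W, arcs = S, tail = tail G, head = head G\<rparr>"
  have W: "finite W" "W \<noteq> {}" and ends: "\<And>e. e \<in> S \<Longrightarrow> tail G e \<in> W \<and> head G e \<in> W"
    using fin S0 by (auto simp: W_def)
  have deg: "card (incident_arcs G S v) \<ge> 2" if "v \<in> W" for v
  proof -
    have "incident_arcs G S v \<noteq> {}" using that by (auto simp: W_def incident_arcs_def)
    then have "card (incident_arcs G S v) \<noteq> 0" using fin by (simp add: incident_arcs_def)
    moreover have "card (incident_arcs G S v) \<noteq> 1" using S by (simp add: P_def)
    ultimately show ?thesis by linarith
  qed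
  have le: "card S \<le> card W"
  proof (rule ccontr)
    assume "\<not> card S \<le> card W"
    obtain e where e: "e \<in> S" using S0 by blast
    have "card W \<le> card (S - {e})"
      using \<open>\<not> card S \<le> card W\<close> e fin by (simp add: card_Diff_singleton)
    then obtain x :: "'e \<Rightarrow> real" where x: "\<exists>e\<in>S - {e}. x e \<noteq> 0" "\<forall>v. net_outflow G (S - {e}) x v = 0"
      using exists_nonzero_real_flow[of "S - {e}" W G] fin W ends by auto
    have "P {e' \<in> S - {e}. x e' \<noteq> 0}"
      unfolding P_def using x SA SG support_no_leaf[of "S - {e}" x] by blast
    then have "{e' \<in> S - {e}. x e' \<noteq> 0} = S" by (rule min') auto
    with e show False by blast
  qed
  \<comment> \<open>The degrees are at least 2 and sum to \<open>2 * card S\<close>, which is at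
    most \<open>2 * card W\<close>; no degree can be larger.\<close>
  have deg2: "card (incident_arcs G S v) = 2" if "v \<in> W" for v
  proof (rule ccontr)
    assume "card (incident_arcs G S v) \<noteq> 2"
    then have "(\<Sum>v\<in>W. 2) < (\<Sum>v\<in>W. card (incident_arcs G S v))"
      using deg that W(1) by (intro sum_strict_mono_ex1) (auto intro!: bexI[of _ v] simp: le_neq_implies_less)
    with handshake[OF SG W(1) ends] le show False by simp
  qed
  have wf: "wf_digraph C" unfolding C_def using ends by unfold_locales auto
  have sub: "subgraph C G"
    using wf SG wf_digraph_axioms by (auto simp: subgraph_def C_def compatible_def W_def)
  have "Digraph_Component.connected C"
  proof (rule connectedI_closed_sets[OF wf])
    show "verts C \<noteq> {}" using W by (simp add: C_def)
    fix u R assume u: "u \<in> verts C" "u \<in> R"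
      and R: "\<And>e. e \<in> arcs C \<Longrightarrow> tail C e \<in> R \<longleftrightarrow> head C e \<in> R"
    have R: "\<And>e. e \<in> S \<Longrightarrow> tail G e \<in> R \<longleftrightarrow> head G e \<in> R" using R by (simp add: C_def)
    \<comment> \<open>The arcs inside a closed set \<open>R\<close> keep all degrees at vertices of
      \<open>R\<close>, so \<open>?T\<close> competes with \<open>S\<close> and minimality gives
      \<open>?T = S\<close>.\<close>
    let ?T = "{e \<in> S. tail G e \<in> R}"
    have "incident_arcs G ?T v = (if v \<in> R then incident_arcs G S v else {})" for v
      using R by (auto simp: incident_arcs_def)
    moreover have "?T \<noteq> {}" using u R by (auto simp: C_def W_def)
    ultimately have "P ?T" using S by (auto simp: P_def)
    then have "?T = S" by (rule min') auto
    then show "verts C \<subseteq> R" using R by (auto simp: C_def W_def)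
  qed
  moreover have "in_degree C v + out_degree C v = 2" if "v \<in> verts C" for v
    using card_incident_arcs[OF sub, of v] deg2[of v] that by (simp add: C_def)
  ultimately show ?thesis
    using sub SA by (intro exI[of _ C]) (simp add: cycle_subgraph_def C_def)
qed

text \<open>
  As all degrees are 2, the zero set of a real flow on the cycle is closed under adjacency of arcs. By
  connectedness a nonzero flow vanishes nowhere, and its signs are the required ones.
\<close>

lemma cycle_signs:
  assumes "cycle_subgraph C G"
  shows "\<exists>s. \<forall>(a::'c::ab_group_add) v. net_outflow G (arcs C) (\<lambda>e. if s e then a else - a) v = 0"
proof -
  have sub: "subgraph C G" and con: "Digraph_Component.connected C"
    and deg: "\<And>v. v \<in> verts C \<Longrightarrow> card (incident_arcs G (arcs C) v) = 2"
    using assms card_incident_arcs by (auto simp: cycle_subgraph_def)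
  have C: "tail C = tail G" "head C = head G" "arcs C \<subseteq> arcs G" "verts C \<subseteq> verts G"
    using sub by (auto simp: subgraph_def compatible_def)
  have fin: "finite (arcs C)" "finite (verts C)" using C finite_arcs finite_verts by (auto intro: finite_subset)
  have ends: "tail G e \<in> verts C \<and> head G e \<in> verts C" if "e \<in> arcs C" for e
    using sub that C(1,2) unfolding subgraph_def by (metis wf_digraph.tail_in_verts wf_digraph.head_in_verts)
  have "verts C \<noteq> {}" using con by (auto simp: Digraph_Component.connected_def strongly_connected_def)
  moreover have "card (verts C) \<le> card (arcs C)"
    using handshake[OF C(3) fin(2) ends] deg by simp
  ultimately obtain x :: "'e \<Rightarrow> real"
    where x: "\<exists>e\<in>arcs C. x e \<noteq> 0" and flow: "\<And>v. net_outflow G (arcs C) x v = 0"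
    using exists_nonzero_real_flow[OF fin _ _ ends] by blast
  \<comment> \<open>The reduction to the two arcs at \<open>v\<close> is stated for real and for
    group values at once: signs read off from \<open>x\<close> must serve the same arcs over the
    group, and a local fact is not polymorphic.\<close>
  have two: "\<exists>e1 e2. incident_arcs G (arcs C) v = {e1, e2} \<and> e1 \<noteq> e2 \<and>
      (\<forall>f :: 'e \<Rightarrow> real. net_outflow G (arcs C) f v = net_outflow G {e1, e2} f v) \<and>
      (\<forall>f :: 'e \<Rightarrow> 'c. net_outflow G (arcs C) f v = net_outflow G {e1, e2} f v)"
    if v: "v \<in> verts C" for v
  proof -
    obtain e1 e2 where e: "incident_arcs G (arcs C) v = {e1, e2}" "e1 \<noteq> e2"
      using deg[OF v] by (auto simp: card_2_iff)
    show ?thesis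
      using e net_outflow_incident_arcs[OF fin(1)] by metis
  qed
  have propagate: "x e' \<noteq> 0"
    if v: "v \<in> verts C" and e: "e \<in> incident_arcs G (arcs C) v" "x e \<noteq> 0"
      and e': "e' \<in> incident_arcs G (arcs C) v" for v e e'
  proof -
    obtain e1 e2 where E: "incident_arcs G (arcs C) v = {e1, e2}" "e1 \<noteq> e2"
      "net_outflow G {e1, e2} x v = 0" using two[OF v] flow[of v] by metis
    have "e1 \<in> arcs C" "e2 \<in> arcs C" "tail G e1 = v \<or> head G e1 = v" "tail G e2 = v \<or> head G e2 = v"
      using E(1) by (auto simp: incident_arcs_def)
    moreover have "tail G e1 \<noteq> head G e1" "tail G e2 \<noteq> head G e2"
      using calculation C(3) no_loops by blast+
    ultimately have "x e1 = 0 \<longleftrightarrow> x e2 = 0"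
      using E(2,3) by (auto simp: net_outflow_def)
    then show ?thesis using e e' E(1) by auto
  qed
  have nz: "x e \<noteq> 0" if "e \<in> arcs C" for e
  proof -
    define R where "R = {v. \<forall>e\<in>incident_arcs G (arcs C) v. x e \<noteq> 0}"
    obtain e0 where e0: "e0 \<in> arcs C" "x e0 \<noteq> 0" using x by blast
    have R: "tail G e \<in> R \<longleftrightarrow> x e \<noteq> 0" "head G e \<in> R \<longleftrightarrow> x e \<noteq> 0" if "e \<in> arcs C" for e
    proof -
      have "e \<in> incident_arcs G (arcs C) (tail G e)" "e \<in> incident_arcs G (arcs C) (head G e)"
        using that by (auto simp: incident_arcs_def)
      then show "tail G e \<in> R \<longleftrightarrow> x e \<noteq> 0" "head G e \<in> R \<longleftrightarrow> x e \<noteq> 0"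
        using ends[OF that] propagate unfolding R_def by blast+
    qed
    have "verts C \<subseteq> R"
      by (rule connected_closed_set[OF con, of "tail G e0"]) (use ends e0 R C in auto)
    then show ?thesis using R that ends by blast
  qed
  \<comment> \<open>At a vertex of the cycle, conservation of \<open>x\<close> says that the values
    on \<open>e1\<close> and \<open>e2\<close> are equal or opposite, depending on the orientations.
    As they are nonzero, their signs obey the same rule, and so do the values \<open>a\<close> and
    \<open>- a\<close>.\<close>
  have "net_outflow G (arcs C) (\<lambda>e. if x e > 0 then a else - a) v = 0" for a :: 'c and v
  proof (cases "v \<in> verts C")
    case True
    obtain e1 e2 where E: "incident_arcs G (arcs C) v = {e1, e2}" "e1 \<noteq> e2"
      "net_outflow G {e1, e2} x v = 0"
      "\<And>f :: 'e \<Rightarrow> 'c. net_outflow G (arcs C) f v = net_outflow G {e1, e2} f v"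
      using two[OF True] flow[of v] by metis
    have "e1 \<in> arcs C" "e2 \<in> arcs C" "tail G e1 = v \<or> head G e1 = v" "tail G e2 = v \<or> head G e2 = v"
      using E(1) by (auto simp: incident_arcs_def)
    moreover have "tail G e1 \<noteq> head G e1" "tail G e2 \<noteq> head G e2" "x e1 \<noteq> 0" "x e2 \<noteq> 0"
      using calculation C(3) no_loops nz by blast+
    ultimately show ?thesis
      unfolding E(4) using E(2,3) by (auto simp: net_outflow_def)
  next
    case False
    then show ?thesis
      unfolding net_outflow_def using ends by (auto intro!: sum.neutral)
  qed
  then show ?thesis by (intro exI[of _ "\<lambda>e. x e > 0"]) blast
qed

section \<open>Steps in the flow graph\<close>

lemma is_flow_iff_net_outflow:
  "is_flow G f \<longleftrightarrow> f \<in> extensional (arcs G) \<and> (\<forall>v\<in>verts G. net_outflow G (arcs G) f v = 0)"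
proof -
  have "net_outflow G (arcs G) f v = (\<Sum>e\<in>out_arcs G v. f e) - (\<Sum>e\<in>in_arcs G v. f e)" for v
    unfolding net_outflow_def sum_subtractf out_arcs_def in_arcs_def
    by (simp add: sum.If_cases Int_def)
  then show ?thesis by (simp add: is_flow_def)
qed

text \<open>The predicate \<open>s\<close> marks the arcs that receive \<open>a\<close> rather than
  \<open>- a\<close>. The restriction to \<open>arcs G\<close> preserves the extensionality demanded
  of flows.\<close>

definition shift_on_cycle :: "('v, 'e) pre_digraph \<Rightarrow> ('e \<Rightarrow> bool) \<Rightarrow> 'c \<Rightarrow> ('e \<Rightarrow> 'c) \<Rightarrow> 'e \<Rightarrow> 'c::ab_group_add" where
  "shift_on_cycle C s a f = (\<lambda>e\<in>arcs G. f e + (if e \<in> arcs C then if s e then a else - a else 0))"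

lemma is_flow_shift_on_cycle:
  assumes "cycle_subgraph C G" "is_flow G f"
    and "\<And>v. net_outflow G (arcs C) (\<lambda>e. if s e then a else - a) v = 0"
  shows "is_flow G (shift_on_cycle C s a f)"
proof -
  have "arcs C \<subseteq> arcs G" using assms(1) by (auto simp: cycle_subgraph_def subgraph_def)
  have "net_outflow G (arcs G) (shift_on_cycle C s a f) v = 0" if "v \<in> verts G" for v
  proof -
    have "net_outflow G (arcs G) (\<lambda>e. if e \<in> arcs C then if s e then a else - a else 0) v
        = net_outflow G (arcs C) (\<lambda>e. if s e then a else - a) v"
      unfolding net_outflow_def
      by (rule sum.mono_neutral_cong_right) (use \<open>arcs C \<subseteq> arcs G\<close> in auto)
    then have "net_outflow G (arcs G) (\<lambda>e. f e + (if e \<in> arcs C then if s e then a else - a else 0)) v = 0"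
      unfolding net_outflow_add using that assms(2,3) by (simp add: is_flow_iff_net_outflow)
    then show ?thesis
      using net_outflow_cong[of "arcs G" "shift_on_cycle C s a f"
          "\<lambda>e. f e + (if e \<in> arcs C then if s e then a else - a else 0)" G v]
      by (simp add: shift_on_cycle_def)
  qed
  then show ?thesis by (simp add: is_flow_iff_net_outflow shift_on_cycle_def)
qed

text \<open>Since \<open>a\<close> is nonzero, so is \<open>- a\<close>, and the two flows differ on
  every arc of the cycle and nowhere else.\<close>

lemma adjacent_shift_on_cycle:
  fixes f :: "'e \<Rightarrow> 'c::ab_group_add"
  assumes "cycle_subgraph C G" "a \<noteq> 0" "nowhere_zero_flow G f"
    and "nowhere_zero_flow G (shift_on_cycle C s a f)"
  shows "(f, shift_on_cycle C s a f) \<in> arcs (flow_graph G TYPE('c))"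
proof -
  have "arcs C \<subseteq> arcs G" using assms(1) by (auto simp: cycle_subgraph_def subgraph_def)
  then have "{e \<in> arcs G. f e - shift_on_cycle C s a f e \<noteq> 0} = arcs C"
    using assms(2) by (auto simp: shift_on_cycle_def)
  then show ?thesis using assms by (auto simp: flow_graph_def)
qed

section \<open>Walks of bounded length between flows\<close>

lemma awalk_flow_graph_Nil:
  fixes f :: "'e \<Rightarrow> 'c::ab_group_add"
  shows "pre_digraph.awalk (flow_graph G TYPE('c)) f [] g \<longleftrightarrow> f = g \<and> nowhere_zero_flow G f"
  unfolding wf_digraph.awalk_Nil_iff[OF wf_digraph_flow_graph] by (simp add: flow_graph_def)

lemma awalk_flow_graph_Cons:
  fixes f :: "'e \<Rightarrow> 'c::ab_group_add"
  shows "pre_digraph.awalk (flow_graph G TYPE('c)) f (a # p) g \<longleftrightarrow>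
    a \<in> arcs (flow_graph G TYPE('c)) \<and> f = fst a \<and> pre_digraph.awalk (flow_graph G TYPE('c)) (snd a) p g"
proof -
  have "tail (flow_graph G TYPE('c)) = fst" "head (flow_graph G TYPE('c)) = snd"
    by (simp_all add: flow_graph_def)
  then show ?thesis
    unfolding wf_digraph.awalk_Cons_iff[OF wf_digraph_flow_graph] by simp
qed

definition walk_within :: "nat \<Rightarrow> ('e \<Rightarrow> 'c::ab_group_add) \<Rightarrow> ('e \<Rightarrow> 'c) \<Rightarrow> bool" where
  "walk_within n f g \<longleftrightarrow>
     (\<exists>p. pre_digraph.awalk (flow_graph G TYPE('c)) f p g \<and> length p \<le> n)"

lemma walk_within_refl: "nowhere_zero_flow G f \<Longrightarrow> walk_within n f f"
  unfolding walk_within_def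
  by (intro exI[of _ "[]"]) (simp add: awalk_flow_graph_Nil)

lemma walk_within_mono: "walk_within m f g \<Longrightarrow> m \<le> n \<Longrightarrow> walk_within n f g"
  unfolding walk_within_def by (meson le_trans)

lemma walk_within_trans:
  fixes f :: "'e \<Rightarrow> 'c::ab_group_add"
  assumes "walk_within m f g" "walk_within n g h"
  shows "walk_within (m + n) f h"
proof -
  obtain p q where "pre_digraph.awalk (flow_graph G TYPE('c)) f p g" "length p \<le> m"
    "pre_digraph.awalk (flow_graph G TYPE('c)) g q h" "length q \<le> n"
    using assms unfolding walk_within_def by blast
  then show ?thesis
    unfolding walk_within_def
    by (intro exI[of _ "p @ q"]) (auto intro: wf_digraph.awalk_appendI[OF wf_digraph_flow_graph])
qed

lemma walk_within_step:
  fixes f :: "'e \<Rightarrow> 'c::ab_group_add"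
  assumes "(f, g) \<in> arcs (flow_graph G TYPE('c))"
  shows "walk_within 1 f g"
proof -
  have "nowhere_zero_flow G g" using assms by (auto simp: flow_graph_def)
  then show ?thesis
    unfolding walk_within_def using assms
    by (intro exI[of _ "[(f, g)]"]) (simp add: awalk_flow_graph_Nil awalk_flow_graph_Cons)
qed

lemma walk_within_sym:
  fixes f :: "'e \<Rightarrow> 'c::ab_group_add"
  assumes "walk_within n f g"
  shows "walk_within n g f"
proof -
  have "walk_within (length p) g f" if "pre_digraph.awalk (flow_graph G TYPE('c)) f p g" for p
    using that
  proof (induction p arbitrary: f)
    case Nil
    then show ?case
      by (auto simp: awalk_flow_graph_Nil intro: walk_within_refl)
  next
    case (Cons e p)
    then obtain f' where e: "e = (f, f')" "(f, f') \<in> arcs (flow_graph G TYPE('c))"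
      and "walk_within (length p) g f'"
      by (cases e) (auto simp: awalk_flow_graph_Cons)
    moreover have "(f', f) \<in> arcs (flow_graph G TYPE('c))"
    proof -
      have "{e \<in> arcs G. f' e - f e \<noteq> 0} = {e \<in> arcs G. f e - f' e \<noteq> 0}" by auto
      then show ?thesis using e(2) by (simp add: flow_graph_def)
    qed
    ultimately show ?case
      using walk_within_trans[OF _ walk_within_step, of "length p" g f' f] by simp
  qed
  then show ?thesis using assms walk_within_mono unfolding walk_within_def by blast
qed

text \<open>Induction on the number of arcs where \<open>p\<close> vanishes; each step removes at
  least one and creates none. Abstracting to \<open>p\<close> with right inverse \<open>i\<close>
  covers both coordinates of the product.\<close>

lemma walk_to_nowhere_zero_projection:
  fixes p :: "'c::ab_group_add \<Rightarrow> 'a::ab_group_add" and i :: "'a \<Rightarrow> 'c"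
  assumes "additive p" and right_inv: "\<And>a. p (i a) = a"
    and large: "infinite (UNIV :: 'a set) \<or> card (UNIV :: 'a set) \<ge> k + 1"
    and short: "\<forall>e\<in>arcs G. \<exists>C. cycle_subgraph C G \<and> e \<in> arcs C \<and> card (arcs C) \<le> k"
    and "nowhere_zero_flow G f"
  shows "\<exists>g. nowhere_zero_flow G g \<and> (\<forall>e\<in>arcs G. p (g e) \<noteq> 0) \<and> walk_within (card (arcs G)) f g"
proof -
  interpret p: additive p by fact
  define Z where "Z f = {e \<in> arcs G. p (f e) = 0}" for f
  have "\<exists>g. nowhere_zero_flow G g \<and> (\<forall>e\<in>arcs G. p (g e) \<noteq> 0) \<and> walk_within (card (Z f)) f g"
    if "nowhere_zero_flow G f" for f
    using that
  proof (induction "card (Z f)" arbitrary: f rule: less_induct)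
    case less
    note f = \<open>nowhere_zero_flow G f\<close>
    have finZ: "finite (Z f)" by (simp add: Z_def)
    show ?case
    proof (cases "Z f = {}")
      case True
      then show ?thesis using f walk_within_refl[OF f] by (auto simp: Z_def)
    next
      case False
      then obtain e0 where e0: "e0 \<in> arcs G" "p (f e0) = 0" by (auto simp: Z_def)
      then obtain C where C: "cycle_subgraph C G" "e0 \<in> arcs C" "card (arcs C) \<le> k"
        using short by blast
      have CG: "arcs C \<subseteq> arcs G" using C(1) by (auto simp: cycle_subgraph_def subgraph_def)
      then have finC: "finite (arcs C)" using finite_arcs by (rule finite_subset)
      obtain s where s: "\<And>(a::'c) v. net_outflow G (arcs C) (\<lambda>e. if s e then a else - a) v = 0"
        using cycle_signs[OF C(1)] by metis
      \<comment> \<open>The forbidden amounts: each arc of \<open>C\<close> rules out the one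
        \<open>a\<close> for which its new projection, \<open>p (f e) + a\<close> or
        \<open>p (f e) - a\<close>, is 0.\<close>
      define F where "F = (\<lambda>e. if s e then - p (f e) else p (f e)) ` arcs C"
      have "card F \<le> k" unfolding F_def using C(3) card_image_le[OF finC] le_trans by blast
      moreover have "finite F" using finC by (simp add: F_def)
      ultimately have "F \<noteq> UNIV" using large by auto
      then obtain a where a: "a \<notin> F" by blast
      \<comment> \<open>The arc \<open>e0\<close> forbids 0 itself, so the chosen shift is a genuine
        step.\<close>
      have "0 \<in> F" unfolding F_def using C(2) e0(2) by (force simp: image_iff)
      with a have "i a \<noteq> 0" using right_inv p.zero by metis
      let ?g = "shift_on_cycle C s (i a) f"
      have pC: "p (?g e) \<noteq> 0" if "e \<in> arcs C" for e
      proof -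
        have "a \<noteq> (if s e then - p (f e) else p (f e))" using a that by (auto simp: F_def)
        then show ?thesis
          using that CG
          by (auto simp: shift_on_cycle_def p.add p.minus p.diff right_inv eq_neg_iff_add_eq_0 add.commute split: if_splits)
      qed
      have notC: "?g e = f e" if "e \<in> arcs G - arcs C" for e
        using that by (simp add: shift_on_cycle_def)
      have g: "nowhere_zero_flow G ?g"
        using f is_flow_shift_on_cycle[OF C(1) _ s] pC notC p.zero
        unfolding nowhere_zero_flow_def by (metis Diff_iff)
      have "Z ?g \<subseteq> Z f" using pC notC unfolding Z_def by fastforce
      moreover have "e0 \<in> Z f - Z ?g" using e0 pC C(2) by (auto simp: Z_def)
      ultimately have lt: "card (Z ?g) < card (Z f)" using finZ by (metis DiffE psubsetI psubset_card_mono)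
      then obtain h where h: "nowhere_zero_flow G h" "\<forall>e\<in>arcs G. p (h e) \<noteq> 0" "walk_within (card (Z ?g)) ?g h"
        using less.hyps g by blast
      have "walk_within 1 f ?g"
        using adjacent_shift_on_cycle[OF C(1) \<open>i a \<noteq> 0\<close> f g] by (rule walk_within_step)
      then have "walk_within (card (Z f)) f h"
        using lt by (intro walk_within_mono[OF walk_within_trans[OF _ h(3)]]) auto
      then show ?thesis using h by blast
    qed
  qed
  moreover have "card (Z f) \<le> card (arcs G)" by (rule card_mono) (auto simp: Z_def)
  ultimately show ?thesis using assms(5) by (blast intro: walk_within_mono)
qed

text \<open>Induction on the number of arcs where the flows differ. All shifts use amounts in the
  kernel of \<open>p\<close>, so the projection stays fixed and keeps every intermediate flow
  nowhere zero.\<close>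

lemma walk_preserving_nowhere_zero_projection:
  fixes p :: "'c::ab_group_add \<Rightarrow> 'a::ab_group_add"
  assumes "additive p" "is_flow G f" "is_flow G g"
    and "\<forall>e\<in>arcs G. p (f e) \<noteq> 0" "\<forall>e\<in>arcs G. p (f e) = p (g e)"
  shows "walk_within (card (arcs G)) f g"
proof -
  interpret p: additive p by fact
  define D where "D f = {e \<in> arcs G. f e \<noteq> g e}" for f
  have nz: "nowhere_zero_flow G f" if "is_flow G f" "\<forall>e\<in>arcs G. p (f e) \<noteq> 0" for f
    using that p.zero by (metis nowhere_zero_flow_def)
  have "walk_within (card (D f)) f g"
    if "is_flow G f" "\<forall>e\<in>arcs G. p (f e) \<noteq> 0" "\<forall>e\<in>arcs G. p (f e) = p (g e)" for f
    using that
  proof (induction "card (D f)" arbitrary: f rule: less_induct)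
    case less
    note f = \<open>is_flow G f\<close> and pf = \<open>\<forall>e\<in>arcs G. p (f e) \<noteq> 0\<close> and pfg = \<open>\<forall>e\<in>arcs G. p (f e) = p (g e)\<close>
    have finD: "finite (D f)" by (simp add: D_def)
    show ?case
    proof (cases "D f = {}")
      case True
      then have "f = g"
        using f assms(3) by (intro extensionalityI[of _ "arcs G"]) (auto simp: D_def is_flow_def)
      then show ?thesis using walk_within_refl nz[OF f pf] by blast
    next
      case False
      \<comment> \<open>Vertices outside \<open>G\<close> are included because the criterion for
        cycles quantifies over all \<open>v\<close>; no arc meets them.\<close>
      have "net_outflow G (arcs G) (\<lambda>e. f e - g e) v = 0" for v
      proof (cases "v \<in> verts G")
        case True
        then show ?thesis
          unfolding net_outflow_diff using f assms(3) by (simp add: is_flow_iff_net_outflow)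
      next
        case False
        then have "\<forall>e\<in>arcs G. tail G e \<noteq> v \<and> head G e \<noteq> v" by auto
        then show ?thesis by (auto simp: net_outflow_def intro!: sum.neutral)
      qed
      then have "card (incident_arcs G (D f) v) \<noteq> 1" for v
        using support_no_leaf[of "arcs G" "\<lambda>e. f e - g e" v] by (simp add: D_def)
      then obtain C where C: "cycle_subgraph C G" "arcs C \<subseteq> D f"
        using exists_cycle_no_leaf[of "D f"] False by (auto simp: D_def)
      have CG: "arcs C \<subseteq> arcs G" using C(1) by (auto simp: cycle_subgraph_def subgraph_def)
      obtain s where s: "\<And>(a::'c) v. net_outflow G (arcs C) (\<lambda>e. if s e then a else - a) v = 0"
        using cycle_signs[OF C(1)] by metis
      have "arcs C \<noteq> {}"
        using C(1) by (fastforce simp: cycle_subgraph_def Digraph_Component.connected_def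
            strongly_connected_def in_degree_def out_degree_def in_arcs_def out_arcs_def)
      then obtain e0 where e0: "e0 \<in> arcs C" by blast
      \<comment> \<open>The sign is chosen so that the shift adds exactly \<open>g e0 - f e0\<close>
        at \<open>e0\<close>, which settles this arc.\<close>
      define a where "a = (if s e0 then g e0 - f e0 else f e0 - g e0)"
      let ?f = "shift_on_cycle C s a f"
      have "a \<noteq> 0" using e0 C(2) by (auto simp: a_def D_def)
      have "p a = 0" using e0 CG pfg by (auto simp: a_def p.diff)
      then have pf': "\<forall>e\<in>arcs G. p (?f e) = p (f e)"
        by (simp add: shift_on_cycle_def p.add p.diff p.minus p.zero)
      have f': "is_flow G ?f" using is_flow_shift_on_cycle[OF C(1) f s] .
      have "?f e0 = g e0" using e0 CG by (auto simp: shift_on_cycle_def a_def)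
      then have "e0 \<in> D f - D ?f" using e0 C(2) by (auto simp: D_def)
      \<comment> \<open>The cycle lies within \<open>D f\<close>, so only arcs that already differed
        are touched.\<close>
      moreover have "D ?f \<subseteq> D f" using C(2) by (auto simp: D_def shift_on_cycle_def split: if_splits)
      ultimately have lt: "card (D ?f) < card (D f)" using finD by (metis DiffE psubsetI psubset_card_mono)
      have "walk_within (card (D ?f)) ?f g"
        using less.hyps[OF lt f'] pf' pf pfg by simp
      moreover have "walk_within 1 f ?f"
        using adjacent_shift_on_cycle[OF C(1) \<open>a \<noteq> 0\<close> nz[OF f pf]] nz[OF f'] pf pf'
        by (intro walk_within_step) simp
      ultimately show ?thesis
        using lt by (intro walk_within_mono[OF walk_within_trans[of 1 f ?f "card (D ?f)" g]]) auto
    qed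
  qed
  moreover have "card (D f) \<le> card (arcs G)" by (rule card_mono) (auto simp: D_def)
  ultimately show ?thesis using assms(2,4,5) by (blast intro: walk_within_mono)
qed

text \<open>Four legs of at most \<open>card (arcs G)\<close> steps each, \<open>f\<close> to
  \<open>f1\<close> to \<open>m\<close> to \<open>g1\<close> to \<open>g\<close>; the last is a
  reversed walk.\<close>

lemma walk_within_prod:
  fixes f g :: "'e \<Rightarrow> 'a::ab_group_add \<times> 'b::ab_group_add"
  assumes short: "\<forall>e\<in>arcs G. \<exists>C. cycle_subgraph C G \<and> e \<in> arcs C \<and> card (arcs C) \<le> k"
    and "infinite (UNIV :: 'a set) \<or> card (UNIV :: 'a set) \<ge> k + 1"
    and "infinite (UNIV :: 'b set) \<or> card (UNIV :: 'b set) \<ge> k + 1"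
    and "nowhere_zero_flow G f" "nowhere_zero_flow G g"
  shows "walk_within (4 * card (arcs G)) f g"
proof -
  have fst: "additive (fst :: 'a \<times> 'b \<Rightarrow> 'a)" and snd: "additive (snd :: 'a \<times> 'b \<Rightarrow> 'b)"
    by (auto simp: additive_def)
  obtain f1 where f1: "nowhere_zero_flow G f1" "\<forall>e\<in>arcs G. fst (f1 e) \<noteq> 0" "walk_within (card (arcs G)) f f1"
    using walk_to_nowhere_zero_projection[OF fst, of "\<lambda>a. (a, 0)", OF _ assms(2) short assms(4)]
    by auto
  obtain g1 where g1: "nowhere_zero_flow G g1" "\<forall>e\<in>arcs G. snd (g1 e) \<noteq> 0" "walk_within (card (arcs G)) g g1"
    using walk_to_nowhere_zero_projection[OF snd, of "\<lambda>b. (0, b)", OF _ assms(3) short assms(5)]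
    by auto
  \<comment> \<open>This mixed flow shares a nowhere-zero first coordinate with \<open>f1\<close>
    and a nowhere-zero second one with \<open>g1\<close>. Conservation holds coordinatewise.\<close>
  define m where "m = (\<lambda>e\<in>arcs G. (fst (f1 e), snd (g1 e)))"
  have flows: "is_flow G f1" "is_flow G g1" using f1 g1 by (auto simp: nowhere_zero_flow_def)
  have "net_outflow G (arcs G) m v = 0" if "v \<in> verts G" for v
  proof -
    have "fst (net_outflow G (arcs G) m v) = fst (net_outflow G (arcs G) f1 v)"
      unfolding net_outflow_additive[OF fst, symmetric] by (rule net_outflow_cong) (simp add: m_def)
    moreover have "snd (net_outflow G (arcs G) m v) = snd (net_outflow G (arcs G) g1 v)"
      unfolding net_outflow_additive[OF snd, symmetric] by (rule net_outflow_cong) (simp add: m_def)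
    ultimately show ?thesis
      using flows that by (simp add: is_flow_iff_net_outflow prod_eq_iff)
  qed
  then have m: "is_flow G m" by (simp add: is_flow_iff_net_outflow m_def)
  have "walk_within (card (arcs G)) f1 m"
    by (rule walk_preserving_nowhere_zero_projection[OF fst flows(1) m])
      (use f1 in \<open>simp_all add: m_def\<close>)
  moreover have "walk_within (card (arcs G)) m g1"
    by (rule walk_preserving_nowhere_zero_projection[OF snd m flows(2)])
      (use g1 in \<open>simp_all add: m_def\<close>)
  ultimately have "walk_within ((card (arcs G) + card (arcs G)) + (card (arcs G) + card (arcs G))) f g"
    by (intro walk_within_trans[OF walk_within_trans[OF f1(3)]]
        walk_within_trans[OF _ walk_within_sym[OF g1(3)]])
  then show ?thesis by (rule walk_within_mono) simp
qed

end

section \<open>Diameter and connectedness of the flow graph\<close>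

theorem theorem6p4:
  fixes G :: "('v, 'e) pre_digraph"
    and k :: nat
  assumes "k \<ge> 3"
    and "fin_digraph G"
    and "loopfree_digraph G"
    and "\<forall>e\<in>arcs G. \<exists>C. cycle_subgraph C G \<and> e \<in> arcs C \<and> card (arcs C) \<le> k"
    and "infinite (UNIV :: 'a::ab_group_add set) \<or> card (UNIV :: 'a set) \<ge> k + 1"
    and "infinite (UNIV :: 'b::ab_group_add set) \<or> card (UNIV :: 'b set) \<ge> k + 1"
  shows "graph_diameter (flow_graph G TYPE('a \<times> 'b)) \<le> enat (4 * card (arcs G)) \<and>
         connected_or_empty (flow_graph G TYPE('a \<times> 'b))"
proof -
  interpret fin_digraph G by fact
  interpret loopfree_digraph G by fact
  interpret fin_loopfree_digraph G by unfold_locales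
  let ?H = "flow_graph G TYPE('a \<times> 'b)"
  interpret H: wf_digraph ?H by (rule wf_digraph_flow_graph)
  have walk: "\<exists>p. H.awalk f p g \<and> length p \<le> 4 * card (arcs G)"
    if "f \<in> verts ?H" "g \<in> verts ?H" for f g
  proof -
    have "nowhere_zero_flow G f" "nowhere_zero_flow G g" using that by (simp_all add: flow_graph_def)
    then show ?thesis
      using walk_within_prod[OF assms(4-6)] unfolding walk_within_def by blast
  qed
  have "graph_distance ?H f g \<le> enat (4 * card (arcs G))" if fg: "f \<in> verts ?H" "g \<in> verts ?H" for f g
  proof -
    obtain p where "H.awalk f p g" "length p \<le> 4 * card (arcs G)" using walk fg by blast
    then show ?thesis
      unfolding graph_distance_def by (intro INF_lower2[of p]) auto
  qed
  \<comment> \<open>A supremum is bounded pair by pair, which also covers a flow graph without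
    vertices.\<close>
  then have "graph_diameter ?H \<le> enat (4 * card (arcs G))"
    unfolding graph_diameter_def by (auto intro!: SUP_least)
  moreover have "Digraph_Component.connected ?H" if "verts ?H \<noteq> {}"
    using that
  proof (rule H.connectedI)
    fix f g assume "f \<in> verts ?H" "g \<in> verts ?H"
    then obtain p where "H.awalk f p g" using walk by blast
    then show "f \<rightarrow>\<^sup>*\<^bsub>mk_symmetric ?H\<^esub> g"
      by (intro H.reachable_mk_symmetricI H.reachable_awalkI)
  qed
  ultimately show ?thesis by (auto simp: connected_or_empty_def)
qed

end
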